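(* Let $d\ge1$ and $n\ge0$, let $\sigma$ be a legal word, let $q$ be its least $d$-trigger (with the convention $q=n+d$ if $\sigma$ has no $d$-trigger), and let $u<v$ be adjacent unread letters above $q$. Then $u$ and $v$ lie in different intervals of the stack $\mathcal S(\sigma)$ if and only if some letter $x$ with $u<x<v$ was read after a $d$-trigger smaller than $u$ (that is, $x$ occurs in $\sigma$ at a position after a $d$-trigger $c<u$ of $\sigma$).
   Context: Fix $d\geq1$ and $n$, and write $[n]=\{1,\ldots,n\}$. A $d$-trigger of a word with distinct letters is the last entry of an increasing subsequence of length $d$ (positions need not be adjacent). A scan state is a pair $(\sigma,S)$. Here $\sigma$ is a word with distinct letters from $[n]$ (the read prefix); letters of $[n]$ not in $\sigma$ are unread. Let $q$ be the least $d$-trigger of $\sigma$, and $q=n+d$ (a virtual value above every letter) if $\sigma$ has no $d$-trigger. The stack $S=(I_1,\ldots,I_s)$ is a list of nonempty sets with $I_1<I_2<\cdots<I_s$ (all elements of $I_j$ smaller than all elements of $I_{j+1}$) whose union is the set of unread letters larger than $q$. These sets are the intervals of the stack; $I_1$ is the active head and $I_2,\dots,I_s$ are the deferred intervals. The initial state is $(\varepsilon,\varnothing)$ (empty prefix, empty stack). For an unread letter $x$, reading $x$ is a legal move, leading to $(\sigma x,S')$, in the following three cases. (a) Merger: $x$ is a $d$-trigger of $\sigma x$ and $x<q$. Let $E$ be the set of unread letters strictly between $x$ and $q$. Then $S'=(E\cup I_1,I_2,\ldots,I_s)$, where $I_1=\varnothing$ if $s=0$, with an empty set deleted. (b) Split: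 $x$ is a $d$-trigger of $\sigma x$, $x>q$, and $x\in I_1$. Then $S'=(I_1^{<x},I_1^{>x},I_2,\ldots,I_s)$, where $I_1^{<x},I_1^{>x}$ are the sets of elements of $I_1$ below and above $x$, with empty sets deleted. (c) Non-trigger move: $x$ is not a $d$-trigger of $\sigma x$. Then $S'=S$. Reading any other unread letter is illegal. (A legal move from a scan state leads to a scan state.) A word $\sigma$ is legal if the initial state reaches a state $(\sigma,S)$ by legal moves; then $S$ is determined by $\sigma$ and denoted $\mathcal S(\sigma)$, the stack of $\sigma$. Two unread letters are adjacent if no unread letter lies strictly between them. *)

theory Defs
  imports Main "HOL-Library.Sublist"
begin

text \<open>
  Words are lists of natural numbers; the letters are the elements of \<open>{1..n}\<close>.
  A stack is a list of sets of letters whose first entry is the active head.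
\<close>

definition is_trigger :: "nat \<Rightarrow> nat list \<Rightarrow> nat \<Rightarrow> bool" where
  "is_trigger d w c \<longleftrightarrow>
     (\<exists>ys. subseq ys w \<and> sorted_wrt (<) ys \<and> length ys = d \<and> ys \<noteq> [] \<and> last ys = c)"

text \<open>The fallback \<open>n + d\<close> is a virtual value; for \<open>d \<ge> 1\<close> it exceeds every letter.\<close>

definition least_trigger :: "nat \<Rightarrow> nat \<Rightarrow> nat list \<Rightarrow> nat" where
  "least_trigger n d w =
     (if \<exists>c. is_trigger d w c then LEAST c. is_trigger d w c else n + d)"

definition unread :: "nat \<Rightarrow> nat list \<Rightarrow> nat set" where
  "unread n w = {1..n} - set w"

definition adjacent_unread :: "nat \<Rightarrow> nat list \<Rightarrow> nat \<Rightarrow> nat \<Rightarrow> bool" where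
  "adjacent_unread n w u v \<longleftrightarrow>
     u \<in> unread n w \<and> v \<in> unread n w \<and> u < v \<and> \<not> (\<exists>y\<in>unread n w. u < y \<and> y < v)"

definition scan_state :: "nat \<Rightarrow> nat \<Rightarrow> nat list \<times> nat set list \<Rightarrow> bool" where
  "scan_state n d = (\<lambda>(w, S).
     distinct w \<and> set w \<subseteq> {1..n} \<and>
     (\<forall>I\<in>set S. I \<noteq> {}) \<and>
     sorted_wrt (\<lambda>I J. \<forall>a\<in>I. \<forall>b\<in>J. a < b) S \<and>
     \<Union> (set S) = {y \<in> unread n w. least_trigger n d w < y})"

definition del_empty :: "nat set list \<Rightarrow> nat set list" where
  "del_empty = filter (\<lambda>I. I \<noteq> {})"

definition head :: "nat set list \<Rightarrow> nat set" where
  "head S = (case S of [] \<Rightarrow> {} | I # _ \<Rightarrow> I)"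

inductive legal_move ::
    "nat \<Rightarrow> nat \<Rightarrow> nat list \<times> nat set list \<Rightarrow> nat list \<times> nat set list \<Rightarrow> bool"
  for n d where
  merger: "legal_move n d (w, S) (w @ [x], del_empty [E \<union> head S] @ tl S)"
    if "scan_state n d (w, S)" "x \<in> unread n w"
       "is_trigger d (w @ [x]) x" "x < least_trigger n d w"
       "E = {y \<in> unread n w. x < y \<and> y < least_trigger n d w}"
| split: "legal_move n d (w, I # S)
            (w @ [x], del_empty [{y \<in> I. y < x}, {y \<in> I. x < y}] @ S)"
    if "scan_state n d (w, I # S)" "x \<in> unread n w"
       "is_trigger d (w @ [x]) x" "x > least_trigger n d w" "x \<in> I"
| non_trigger: "legal_move n d (w, S) (w @ [x], S)"
    if "scan_state n d (w, S)" "x \<in> unread n w"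
       "\<not> is_trigger d (w @ [x]) x"

definition reachable :: "nat \<Rightarrow> nat \<Rightarrow> nat list \<Rightarrow> nat set list \<Rightarrow> bool" where
  "reachable n d w S \<longleftrightarrow> (legal_move n d)\<^sup>*\<^sup>* ([], []) (w, S)"

definition legal :: "nat \<Rightarrow> nat \<Rightarrow> nat list \<Rightarrow> bool" where
  "legal n d w \<longleftrightarrow> (\<exists>S. reachable n d w S)"

text \<open>Only meaningful for legal words; \<open>reachable_unique\<close> below shows that the description is
  then a proper one.\<close>

definition stack :: "nat \<Rightarrow> nat \<Rightarrow> nat list \<Rightarrow> nat set list" where
  "stack n d w = (THE S. reachable n d w S)"

definition in_different_intervals :: "nat set list \<Rightarrow> nat \<Rightarrow> nat \<Rightarrow> bool" where
  "in_different_intervals S u v \<longleftrightarrow>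
     (\<exists>I\<in>set S. \<exists>J\<in>set S. u \<in> I \<and> v \<in> J \<and> I \<noteq> J)"

definition read_after :: "nat list \<Rightarrow> nat \<Rightarrow> nat \<Rightarrow> bool" where
  "read_after w c x \<longleftrightarrow> (\<exists>i j. i < j \<and> j < length w \<and> w ! i = c \<and> w ! j = x)"


lemma legal_move_deterministic:
  assumes "legal_move n d (w, S) (w @ [x], S1)" "legal_move n d (w, S) (w @ [x], S2)"
  shows "S1 = S2"
  using assms by (auto elim!: legal_move.cases simp: head_def)

lemma reachable_snocD:
  assumes "reachable n d (w @ [x]) S"
  shows "\<exists>S0. reachable n d w S0 \<and> legal_move n d (w, S0) (w @ [x], S)"
  using assms unfolding reachable_def
  by (cases rule: rtranclp.cases) (auto elim!: legal_move.cases intro: legal_move.intros)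

lemma reachable_Nil: "reachable n d [] S \<longleftrightarrow> S = []"
  unfolding reachable_def by (auto elim: rtranclp.cases legal_move.cases)

lemma reachable_unique:
  assumes "reachable n d w S" "reachable n d w S'"
  shows "S = S'"
  using assms
proof (induction w arbitrary: S S' rule: rev_induct)
  case Nil
  then show ?case by (simp add: reachable_Nil)
next
  case (snoc x w)
  obtain S0 S0' where "reachable n d w S0" "legal_move n d (w, S0) (w @ [x], S)"
      "reachable n d w S0'" "legal_move n d (w, S0') (w @ [x], S')"
    using snoc.prems reachable_snocD by metis
  then show ?case using snoc.IH legal_move_deterministic by blast
qed

lemma stack_eq: "reachable n d w S \<Longrightarrow> stack n d w = S"
  unfolding stack_def by (blast intro: reachable_unique)

lemma is_trigger_snoc:
  assumes "c \<noteq> x"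
  shows "is_trigger d (w @ [x]) c \<longleftrightarrow> is_trigger d w c"
proof
  assume "is_trigger d (w @ [x]) c"
  then obtain ys where ys: "subseq ys (w @ [x])" "sorted_wrt (<) ys" "length ys = d"
      "ys \<noteq> []" "last ys = c"
    unfolding is_trigger_def by blast
  then obtain as bs where ab: "ys = as @ bs" "subseq as w" "subseq bs [x]"
    by (auto simp: subseq_append_iff)
  have "bs = []"
  proof (rule ccontr)
    assume "bs \<noteq> []"
    then have "last ys = last bs" "last bs \<in> set bs" using ab by auto
    moreover have "set bs \<subseteq> {x}"
      using list_emb_set[OF ab(3)] by auto
    ultimately show False using ys assms by auto
  qed
  then show "is_trigger d w c" using ys ab unfolding is_trigger_def by auto
next
  assume "is_trigger d w c"
  then show "is_trigger d (w @ [x]) c"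
    unfolding is_trigger_def using list_emb_prefix[of "(=)" _ w "[x]"] by blast
qed

lemma is_trigger_in_set: "is_trigger d w c \<Longrightarrow> c \<in> set w"
proof (induction w rule: rev_induct)
  case Nil
  then show ?case by (auto simp: is_trigger_def)
next
  case (snoc x w)
  then show ?case by (cases "c = x") (auto simp: is_trigger_snoc)
qed

lemma is_trigger_above:
  assumes "is_trigger d w c" "c < x"
  shows "is_trigger d (w @ [x]) x"
proof -
  obtain ys where ys: "subseq ys w" "sorted_wrt (<) ys" "length ys = d" "ys \<noteq> []" "last ys = c"
    using assms unfolding is_trigger_def by blast
  obtain zs where zs: "ys = zs @ [c]" using ys(4,5) by (metis append_butlast_last_id)
  have sorted: "sorted_wrt (<) (ys @ [x])"
    using ys(2) assms(2) unfolding zs by (auto simp: sorted_wrt_append)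
  have sub: "subseq (ys @ [x]) (w @ [x])" using ys(1) by simp
  obtain y ts where y: "ys = y # ts" using ys(4) by (cases ys) auto
  have "subseq (ts @ [x]) (w @ [x])" using sub subseq_Cons' unfolding y by fastforce
  moreover have "sorted_wrt (<) (ts @ [x])" "length (ts @ [x]) = d" "ts @ [x] \<noteq> []" "last (ts @ [x]) = x"
    using sorted ys(3) unfolding y by auto
  ultimately show ?thesis unfolding is_trigger_def by blast
qed

lemma least_trigger_le: "is_trigger d w c \<Longrightarrow> least_trigger n d w \<le> c"
  by (auto simp: least_trigger_def intro: Least_le)

lemma least_trigger_snoc_trigger:
  assumes "is_trigger d (w @ [x]) x" "x \<in> {1..n}" "d \<ge> 1"
  shows "least_trigger n d (w @ [x]) = min x (least_trigger n d w)"
proof (cases "\<exists>c. is_trigger d w c \<and> c \<noteq> x")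
  case False
  then have "is_trigger d (w @ [x]) = (\<lambda>c. c = x)"
    using assms(1) is_trigger_snoc by blast
  moreover have "x \<le> least_trigger n d w"
    using False assms(2) by (auto simp: least_trigger_def intro: LeastI2_ex)
  moreover have "(LEAST c. c = x) = x" by (rule Least_equality) auto
  ultimately show ?thesis unfolding least_trigger_def[of n d "w @ [x]"] by simp
next
  case True
  then have ex: "\<exists>c. is_trigger d w c" by blast
  define q where "q = least_trigger n d w"
  have q: "is_trigger d w q" using ex unfolding q_def least_trigger_def by (simp add: LeastI_ex)
  have "(LEAST c. is_trigger d (w @ [x]) c) = min x q"
  proof (rule Least_equality)
    show "is_trigger d (w @ [x]) (min x q)"
      using q assms(1) is_trigger_snoc[of q x] by (cases "q = x") (auto simp: min_def)
    show "min x q \<le> c" if "is_trigger d (w @ [x]) c" for c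
      using that is_trigger_snoc[of c x d w] least_trigger_le[of d w c n]
      by (cases "c = x") (auto simp: q_def)
  qed
  then show ?thesis using assms(1) unfolding q_def least_trigger_def[of n d "w @ [x]"] by auto
qed

lemma least_trigger_snoc_non_trigger:
  assumes "\<not> is_trigger d (w @ [x]) x" "x \<notin> set w"
  shows "least_trigger n d (w @ [x]) = least_trigger n d w"
proof -
  have "is_trigger d (w @ [x]) = is_trigger d w"
    using assms is_trigger_snoc[of _ x d w] is_trigger_in_set[of d w x] by (intro ext) metis
  then show ?thesis by (simp add: least_trigger_def)
qed

lemma non_trigger_le_least:
  assumes "\<not> is_trigger d (w @ [x]) x" "x \<in> {1..n}"
  shows "x \<le> least_trigger n d w"
proof (cases "\<exists>c. is_trigger d w c")
  case True
  then have "is_trigger d w (least_trigger n d w)"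
    by (simp add: least_trigger_def LeastI_ex)
  then show ?thesis using assms is_trigger_above by (meson not_less)
qed (use assms in \<open>auto simp: least_trigger_def\<close>)

lemma scan_state_initial: "scan_state n d ([], [])"
  by (auto simp: scan_state_def least_trigger_def unread_def is_trigger_def)

lemma scan_state_move:
  assumes "legal_move n d s t" "d \<ge> 1"
  shows "scan_state n d t"
  using assms(1)
proof cases
  case (merger w S x E)
  define q where "q = least_trigger n d w"
  have x: "x \<in> {1..n}" "x \<notin> set w" using merger by (auto simp: unread_def)
  have q': "least_trigger n d (w @ [x]) = x"
    using least_trigger_snoc_trigger[of d w x n] merger x assms(2) by auto
  have S: "distinct w" "set w \<subseteq> {1..n}" "\<forall>I\<in>set S. I \<noteq> {}"
    "sorted_wrt (\<lambda>I J. \<forall>a\<in>I. \<forall>b\<in>J. a < b) S" "\<Union> (set S) = {y \<in> unread n w. q < y}"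
    using merger(3) by (auto simp: scan_state_def q_def)
  have E: "E = {y \<in> unread n w. x < y \<and> y < q}" using merger by (simp add: q_def)
  have xq: "x < q" using merger by (simp add: q_def)
  have qu: "q \<notin> unread n w"
    using is_trigger_in_set[OF LeastI_ex[of "is_trigger d w"]] assms(2)
    unfolding q_def least_trigger_def unread_def by auto
  have above: "\<forall>I\<in>set S. \<forall>y\<in>I. q < y" using S(5) by auto
  have un: "E \<union> \<Union> (set S) = {y \<in> unread n (w @ [x]). x < y}"
  proof -
    have "q < y \<or> y < q" if "y \<in> unread n w" for y
      using that qu by (metis linorder_neqE_nat)
    then have "E \<union> \<Union> (set S) = {y \<in> unread n w. x < y}"
      unfolding E S(5) using xq by auto
    then show ?thesis by (auto simp: unread_def)
  qed
  show ?thesis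
  proof (cases S)
    case Nil
    then show ?thesis using merger(2) S x q' un
      by (auto simp: scan_state_def head_def del_empty_def)
  next
    case (Cons I R)
    have "\<forall>a\<in>E. \<forall>J\<in>set R. \<forall>b\<in>J. a < b"
      using above unfolding E Cons by fastforce
    then show ?thesis using merger(2) S x q' un unfolding Cons
      by (auto simp: scan_state_def head_def del_empty_def)
  qed
next
  case (split w I S x)
  define q where "q = least_trigger n d w"
  have x: "x \<in> {1..n}" "x \<notin> set w" using split by (auto simp: unread_def)
  have q': "least_trigger n d (w @ [x]) = q"
    using least_trigger_snoc_trigger[of d w x n] split x assms(2) by (auto simp: q_def)
  have S: "distinct w" "set w \<subseteq> {1..n}" "\<forall>J\<in>set (I # S). J \<noteq> {}"
    "sorted_wrt (\<lambda>I J. \<forall>a\<in>I. \<forall>b\<in>J. a < b) (I # S)"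
    "I \<union> \<Union> (set S) = {y \<in> unread n w. q < y}"
    using split(3) by (auto simp: scan_state_def q_def)
  have "x \<notin> J" if "J \<in> set S" for J using S(4) that \<open>x \<in> I\<close> by auto
  then have "{y \<in> I. y < x} \<union> {y \<in> I. x < y} \<union> \<Union> (set S) = (I \<union> \<Union> (set S)) - {x}"
    by auto
  also have "\<dots> = {y \<in> unread n (w @ [x]). q < y}" unfolding S(5) by (auto simp: unread_def)
  finally have un: "\<Union> (set (del_empty [{y \<in> I. y < x}, {y \<in> I. x < y}] @ S)) = \<dots>"
    by (auto simp: del_empty_def)
  have "sorted_wrt (\<lambda>I J. \<forall>a\<in>I. \<forall>b\<in>J. a < b) (del_empty [{y \<in> I. y < x}, {y \<in> I. x < y}] @ S)"
    using S(4) by (auto simp: del_empty_def)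
  moreover have "\<forall>J\<in>set (del_empty [{y \<in> I. y < x}, {y \<in> I. x < y}] @ S). J \<noteq> {}"
    using S(3) by (auto simp: del_empty_def)
  ultimately show ?thesis using split(2) S x q' un unfolding scan_state_def by auto
next
  case (non_trigger w S x)
  then show ?thesis
    using least_trigger_snoc_non_trigger[of d w x n] non_trigger_le_least[of d w x n]
    by (auto simp: scan_state_def unread_def)
qed

end

theory Submission
  imports Defs
begin

text \<open>
  The proof is an induction along the reading order. Say that \<open>u < v\<close> is \<^emph>\<open>separated\<close> in \<open>w\<close>
  when some letter strictly between them was read after a trigger smaller than \<open>u\<close>. Reading a
  letter outside the gap between \<open>u\<close> and \<open>v\<close> never changes this property
  (\<open>separated_snoc_outside\<close>), since a letter just read has nothing after it; and a separated pair
  has \<open>u\<close> above the least trigger \<open>q\<close> (\<open>separated_imp_least_trigger_less\<close>). It remains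
  to compare with what a move does to the stack.

  A non-trigger \<open>x\<close> lies below \<open>q\<close>, hence outside every gap above \<open>q\<close>, and the stack is unchanged.

  A split at \<open>x\<close> changes the position of \<open>u\<close> relative to \<open>v\<close> only if \<open>u < x < v\<close>. In that case
  the two letters come to lie in different intervals, and \<open>x\<close> itself has been read after the
  trigger \<open>q < u\<close>.

  A merger at \<open>x < q\<close> brings new letters, those between \<open>x\<close> and \<open>q\<close>, above the least trigger. If
  \<open>u > q\<close>, nothing changes for the pair. If \<open>u < q\<close>, adjacency forces \<open>v\<close> to be either another
  new letter or the smallest old one; in both cases it ends up with \<open>u\<close> in the head
  (\<open>adjacent_across_least_trigger_in_head\<close>). The pair is not separated either, because before
  this move no trigger was smaller than \<open>u\<close>.

  The induction stays within adjacent pairs: when the gap of a pair adjacent after a move does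
  not contain the letter read, the pair was already adjacent before. For arbitrary pairs the
  equivalence fails. With \<open>d = 1\<close> and \<open>n = 6\<close>, reading \<open>3\<close>, \<open>5\<close>, \<open>1\<close> yields the stack
  \<open>{2, 4}, {6}\<close>, but no letter was read after a trigger smaller than \<open>2\<close>.
\<close>

definition separated :: "nat \<Rightarrow> nat list \<Rightarrow> nat \<Rightarrow> nat \<Rightarrow> bool" where
  "separated d w u v \<longleftrightarrow>
     (\<exists>x c. u < x \<and> x < v \<and> is_trigger d w c \<and> c < u \<and> read_after w c x)"

definition same_interval :: "nat set list \<Rightarrow> nat \<Rightarrow> nat \<Rightarrow> bool" where
  "same_interval S u v \<longleftrightarrow> (\<exists>I\<in>set S. u \<in> I \<and> v \<in> I)"

lemma read_after_snoc:
  "read_after (w @ [y]) c x \<longleftrightarrow> read_after w c x \<or> x = y \<and> c \<in> set w"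
proof
  assume "read_after (w @ [y]) c x"
  then obtain i j where ij: "i < j" "j < length w + 1" "(w @ [y]) ! i = c" "(w @ [y]) ! j = x"
    by (auto simp: read_after_def)
  show "read_after w c x \<or> x = y \<and> c \<in> set w"
  proof (cases "j = length w")
    case True
    then show ?thesis using ij by (auto simp: nth_append)
  next
    case False
    then have "j < length w" using ij by simp
    then show ?thesis using ij by (auto simp: nth_append read_after_def)
  qed
next
  assume "read_after w c x \<or> x = y \<and> c \<in> set w"
  then show "read_after (w @ [y]) c x"
  proof
    assume "read_after w c x"
    then obtain i j where "i < j" "j < length w" "w ! i = c" "w ! j = x"
      by (auto simp: read_after_def)
    then show ?thesis unfolding read_after_def
      by (intro exI[of _ i] exI[of _ j]) (auto simp: nth_append)
  next
    assume xy: "x = y \<and> c \<in> set w"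
    then obtain i where "i < length w" "w ! i = c" by (auto simp: in_set_conv_nth)
    then show ?thesis using xy unfolding read_after_def
      by (intro exI[of _ i] exI[of _ "length w"]) (auto simp: nth_append)
  qed
qed

lemma read_after_in_set: "read_after w c x \<Longrightarrow> c \<in> set w"
  by (auto simp: read_after_def)

text \<open>
  The letter \<open>y\<close> may itself be a new trigger below \<open>u\<close>, but no letter has been read after it yet,
  so it cannot witness a separation.
\<close>

lemma separated_snoc_outside:
  assumes "y \<notin> set w" "\<not> (u < y \<and> y < v)"
  shows "separated d (w @ [y]) u v \<longleftrightarrow> separated d w u v"
proof -
  have "is_trigger d (w @ [y]) c \<longleftrightarrow> is_trigger d w c" if "read_after w c x" for c x
    using read_after_in_set[OF that] assms(1) is_trigger_snoc by metis
  then show ?thesis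
    using assms(2) unfolding separated_def read_after_snoc by blast
qed

lemma separated_snoc_inside:
  assumes "is_trigger d w c" "c < u" "u < y" "y < v"
  shows "separated d (w @ [y]) u v"
  using assms is_trigger_in_set[OF assms(1)] is_trigger_snoc[of c y d w]
  unfolding separated_def read_after_snoc by fastforce

lemma separated_imp_least_trigger_less: "separated d w u v \<Longrightarrow> least_trigger n d w < u"
  unfolding separated_def using least_trigger_le le_less_trans by blast

lemma least_trigger_is_trigger:
  assumes "least_trigger n d w \<le> n" "d \<ge> 1"
  shows "is_trigger d w (least_trigger n d w)"
  using assms by (auto simp: least_trigger_def intro: LeastI_ex split: if_splits)

lemma least_trigger_not_unread:
  assumes "d \<ge> 1"
  shows "least_trigger n d w \<notin> unread n w"
  using assms least_trigger_is_trigger[of n d w] is_trigger_in_set[of d w]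
  by (auto simp: unread_def)

lemma adjacent_unread_snoc_outside:
  assumes "adjacent_unread n (w @ [y]) u v" "\<not> (u < y \<and> y < v)"
  shows "adjacent_unread n w u v"
  using assms unfolding adjacent_unread_def unread_def by auto

text \<open>
  The intervals of a scan state are pairwise disjoint and cover the unread letters above the
  least trigger, so on such letters the two ways of comparing positions are complementary.
\<close>

lemma in_different_intervals_iff_not_same_interval:
  assumes "scan_state n d (w, S)" "u \<in> unread n w" "v \<in> unread n w"
    "least_trigger n d w < u" "least_trigger n d w < v"
  shows "in_different_intervals S u v \<longleftrightarrow> \<not> same_interval S u v"
proof -
  have sorted: "sorted_wrt (\<lambda>I J. \<forall>a\<in>I. \<forall>b\<in>J. a < b) S"
    and cover: "\<Union> (set S) = {y \<in> unread n w. least_trigger n d w < y}"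
    using assms(1) by (auto simp: scan_state_def)
  have disjoint: "I = J" if "I \<in> set S" "J \<in> set S" "z \<in> I" "z \<in> J" for I J z
    using sorted that by (induction S) auto
  have "u \<in> \<Union> (set S)" "v \<in> \<Union> (set S)" unfolding cover using assms by auto
  then show ?thesis
    unfolding in_different_intervals_def same_interval_def using disjoint by blast
qed

text \<open>
  An adjacent pair straddling the least trigger has no unread letter between that trigger and its
  upper member, which is therefore the smallest letter on the stack.
\<close>

lemma adjacent_across_least_trigger_in_head:
  assumes "scan_state n d (w, S)" "adjacent_unread n w u v"
    "u < least_trigger n d w" "least_trigger n d w < v"
  shows "v \<in> head S"
proof -
  have ne: "\<forall>I\<in>set S. I \<noteq> {}"
    and sorted: "sorted_wrt (\<lambda>I J. \<forall>a\<in>I. \<forall>b\<in>J. a < b) S"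
    and cover: "\<Union> (set S) = {y \<in> unread n w. least_trigger n d w < y}"
    using assms(1) by (auto simp: scan_state_def)
  have v: "v \<in> \<Union> (set S)" unfolding cover using assms by (auto simp: adjacent_unread_def)
  then obtain I R where S: "S = I # R" by (cases S) auto
  obtain a where a: "a \<in> I" using ne S by auto
  have "a \<in> unread n w" "least_trigger n d w < a" using cover a S by auto
  then have "v \<le> a"
    using assms unfolding adjacent_unread_def by (meson less_trans not_less)
  then show ?thesis using v sorted a unfolding S head_def by fastforce
qed

lemma same_interval_Nil [simp]: "\<not> same_interval [] u v"
  by (simp add: same_interval_def)

lemma same_interval_Cons [simp]:
  "same_interval (I # S) u v \<longleftrightarrow> u \<in> I \<and> v \<in> I \<or> same_interval S u v"
  by (simp add: same_interval_def)

lemma same_interval_append [simp]: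
  "same_interval (S @ T) u v \<longleftrightarrow> same_interval S u v \<or> same_interval T u v"
  by (induction S) auto

lemma same_interval_del_empty [simp]: "same_interval (del_empty S) u v \<longleftrightarrow> same_interval S u v"
  by (induction S) (auto simp: del_empty_def)

lemma same_interval_split:
  assumes "sorted_wrt (\<lambda>I J. \<forall>a\<in>I. \<forall>b\<in>J. a < b) (I # S)" "x \<in> I" "u \<noteq> x" "v \<noteq> x" "u < v"
  shows "same_interval (del_empty [{y \<in> I. y < x}, {y \<in> I. x < y}] @ S) u v \<longleftrightarrow>
    same_interval (I # S) u v \<and> \<not> (u < x \<and> x < v)"
proof -
  have "x < u" if "same_interval S u v"
    using that assms(1,2) unfolding same_interval_def by auto
  then show ?thesis using assms(3-5) by auto
qed

lemma same_interval_merger_above: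
  assumes "\<forall>y\<in>E. y < q" "q < u" "q < v"
  shows "same_interval (del_empty [E \<union> head S] @ tl S) u v \<longleftrightarrow> same_interval S u v"
  using assms by (cases S) (auto simp: head_def)

lemma same_interval_merger_head:
  assumes "u \<in> E" "v \<in> E \<union> head S"
  shows "same_interval (del_empty [E \<union> head S] @ tl S) u v"
  using assms by simp

lemma reachable_scan_state:
  assumes "reachable n d w S" "d \<ge> 1"
  shows "scan_state n d (w, S)"
proof -
  have "(legal_move n d)\<^sup>*\<^sup>* ([], []) t \<Longrightarrow> scan_state n d t" for t
    by (induction rule: rtranclp_induct) (auto intro: scan_state_initial scan_state_move assms(2))
  then show ?thesis using assms(1) unfolding reachable_def by blast
qed

lemma same_interval_iff_not_separated:
  assumes "reachable n d w S" "d \<ge> 1" "adjacent_unread n w u v" "least_trigger n d w < u"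
  shows "same_interval S u v \<longleftrightarrow> \<not> separated d w u v"
  using assms
proof (induction w arbitrary: S u v rule: rev_induct)
  case Nil
  (* With nothing read, the least trigger is n + d, which exceeds every letter. *)
  moreover have "\<not> is_trigger d [] c" for c using is_trigger_in_set by fastforce
  ultimately show ?case by (simp add: least_trigger_def adjacent_unread_def unread_def)
next
  case (snoc x w)
  obtain S0 where S0: "reachable n d w S0" and move: "legal_move n d (w, S0) (w @ [x], S)"
    using snoc.prems(1) reachable_snocD by blast
  define q where "q = least_trigger n d w"
  have uv: "u < v" "u \<noteq> x" "v \<noteq> x" "u \<in> {1..n}"
    using snoc.prems(3) by (auto simp: adjacent_unread_def unread_def)
  note state = reachable_scan_state[OF S0 \<open>d \<ge> 1\<close>]
  have sorted: "sorted_wrt (\<lambda>I J. \<forall>a\<in>I. \<forall>b\<in>J. a < b) S0"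
    using state by (simp add: scan_state_def)
  (* A pair above the old least trigger whose gap avoids x satisfies the induction hypothesis,
     and its separation is not affected by reading x. *)
  have old: "same_interval S0 u v \<longleftrightarrow> \<not> separated d (w @ [x]) u v"
    if "x \<in> unread n w" "\<not> (u < x \<and> x < v)" "q < u"
    using snoc.IH[OF S0 \<open>d \<ge> 1\<close>] adjacent_unread_snoc_outside[OF snoc.prems(3)]
      separated_snoc_outside[of x w u v d] that
    by (auto simp: q_def unread_def)
  show ?case
    using move
  proof cases
    case (merger E)
    have q': "least_trigger n d (w @ [x]) = x"
      using least_trigger_snoc_trigger[of d w x n] merger \<open>d \<ge> 1\<close> by (auto simp: unread_def)
    have xu: "x < u" using snoc.prems(4) q' by simp
    have adj: "adjacent_unread n w u v"
      using adjacent_unread_snoc_outside[OF snoc.prems(3)] xu by simp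
    have E: "E = {y \<in> unread n w. x < y \<and> y < q}" using merger by (simp add: q_def)
    have uv_ne_q: "u \<noteq> q" "v \<noteq> q"
      using adj least_trigger_not_unread[OF \<open>d \<ge> 1\<close>, of n w]
      by (auto simp: q_def adjacent_unread_def)
    show ?thesis
    proof (cases "q < u")
      case True
      have "same_interval S u v \<longleftrightarrow> same_interval S0 u v"
        using same_interval_merger_above[of E q u v S0] True uv(1) merger(1) E by simp
      then show ?thesis using old merger(3) xu True by simp
    next
      case False
      then have uq: "u < q" using uv_ne_q by simp
      have "u \<in> E" using adj xu uq by (simp add: E adjacent_unread_def)
      moreover have "v \<in> E \<union> head S0"
      proof (cases "v < q")
        case True
        then show ?thesis using adj xu uv(1) by (simp add: E adjacent_unread_def)
      next
        case False
        then show ?thesis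
          using adjacent_across_least_trigger_in_head[OF state adj] uq uv_ne_q
          by (simp add: q_def)
      qed
      ultimately have "same_interval S u v"
        using same_interval_merger_head[of u E v S0] merger(1) by simp
      moreover have "\<not> separated d (w @ [x]) u v"
        using separated_snoc_outside[of x w u v d] separated_imp_least_trigger_less[of d w u v n]
          merger(3) xu uq by (auto simp: q_def unread_def)
      ultimately show ?thesis by simp
    qed
  next
    case (split I R)
    have q': "least_trigger n d (w @ [x]) = q"
      using least_trigger_snoc_trigger[of d w x n] split \<open>d \<ge> 1\<close> by (auto simp: unread_def q_def)
    have qu: "q < u" using snoc.prems(4) q' by simp
    have S: "same_interval S u v \<longleftrightarrow> same_interval S0 u v \<and> \<not> (u < x \<and> x < v)"
      using same_interval_split[of I R x u v] sorted split uv by simp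
    show ?thesis
    proof (cases "u < x \<and> x < v")
      case True
      have "is_trigger d w q"
        using least_trigger_is_trigger[of n d w] qu uv(4) \<open>d \<ge> 1\<close> by (simp add: q_def)
      then show ?thesis using S True separated_snoc_inside qu by blast
    next
      case False
      then show ?thesis using S old split(4) qu by simp
    qed
  next
    case non_trigger
    have q': "least_trigger n d (w @ [x]) = q"
      using least_trigger_snoc_non_trigger[of d w x n] non_trigger by (auto simp: unread_def q_def)
    have "x \<le> q"
      using non_trigger_le_least[of d w x n] non_trigger by (auto simp: unread_def q_def)
    then have "same_interval S0 u v \<longleftrightarrow> \<not> separated d (w @ [x]) u v"
      using snoc.prems(4) by (intro old[OF non_trigger(3)]) (auto simp: q')
    then show ?thesis by (simp only: non_trigger(1))
  qed
qed

theorem lemma2p7: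
  fixes n d q u v :: nat and \<sigma> :: "nat list"
  assumes "d \<ge> 1"
    and "legal n d \<sigma>"
    and "q = least_trigger n d \<sigma>"
    and "adjacent_unread n \<sigma> u v"
    and "q < u"
  shows "in_different_intervals (stack n d \<sigma>) u v \<longleftrightarrow>
    (\<exists>x c. u < x \<and> x < v \<and> is_trigger d \<sigma> c \<and> c < u \<and> read_after \<sigma> c x)"
proof -
  obtain S where S: "reachable n d \<sigma> S" using assms(2) by (auto simp: legal_def)
  have uv: "u \<in> unread n \<sigma>" "v \<in> unread n \<sigma>" "u < v"
    using assms(4) by (auto simp: adjacent_unread_def)
  have "in_different_intervals S u v \<longleftrightarrow> \<not> same_interval S u v"
    using in_different_intervals_iff_not_same_interval[OF reachable_scan_state[OF S assms(1)]]
      uv assms(3,5) by simp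
  then show ?thesis
    using same_interval_iff_not_separated[OF S assms(1,4)] assms(3,5)
    unfolding stack_eq[OF S] separated_def by blast
qed

end
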